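(* For every integer $n\geq 0$, the Bernoulli-Fibonacci polynomial $B_n^F(x)$ can be represented as $$B_n^F(x) = \sum_{j=0}^n {n \brack j}_F\, b_j^F\, x^{n-j}.$$
   Context: Let $F_n$ be the Fibonacci numbers ($F_0=0$, $F_1=F_2=1$, $F_{n+1}=F_n+F_{n-1}$). The Fibonacci factorial is $F_n! = F_1F_2\cdots F_n$ for $n\ge 1$, with $F_0! = 1$. The Fibonomial coefficients are ${n \brack k}_F = \frac{F_n!}{F_{n-k}!\,F_k!}$ for integers $n\geq k\geq 0$. The Golden exponential function is $e_F^x = \sum_{n=0}^\infty \frac{x^n}{F_n!}$ (written $e_F^{zx}$ when evaluated at $zx$). The Bernoulli-Fibonacci polynomials $B_n^F(x)$, $n\geq 0$, are defined by the generating function (power series in $z$) $$\frac{z\, e_F^{zx}}{e_F^{z}-1} = \sum_{n=0}^\infty B_n^F(x)\frac{z^n}{F_n!}.$$ The Bernoulli-Fibonacci numbers are $b_n^F = B_n^F(0)$; equivalently $\frac{z}{e_F^z-1} = \sum_{n=0}^\infty b_n^F \frac{z^n}{F_n!}$. *)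

theory Defs
  imports "HOL-Computational_Algebra.Formal_Power_Series" "HOL-Number_Theory.Fib"
begin

definition fib_fact :: "nat \<Rightarrow> nat" where
  "fib_fact n = (\<Prod>i=1..n. fib i)"

text \<open>A quotient in the field, meaningful only for \<open>k \<le> n\<close> because of truncated subtraction.\<close>

definition fibonomial :: "nat \<Rightarrow> nat \<Rightarrow> 'a::field_char_0" where
  "fibonomial n k = of_nat (fib_fact n) / (of_nat (fib_fact (n - k)) * of_nat (fib_fact k))"

text \<open>
  The Golden exponential evaluated at \<open>z x\<close>, as a formal power series in \<open>z\<close>
  (the argument is \<open>x\<close>, following the convention of \<^const>\<open>fps_exp\<close>).
\<close>

definition fib_exp :: "'a::field_char_0 \<Rightarrow> 'a fps" where
  "fib_exp x = Abs_fps (\<lambda>n. x ^ n / of_nat (fib_fact n))"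

text \<open>
  The division is that of formal power series over a field: numerator and denominator both
  have subdegree 1, so the quotient exists and is exact; see \<open>bernoulli_fib_gen_unique\<close> below.
\<close>

definition bernoulli_fib_gen :: "'a::field_char_0 \<Rightarrow> 'a fps" where
  "bernoulli_fib_gen x = (fps_X * fib_exp x) / (fib_exp 1 - 1)"

definition bernoulli_fib_poly :: "nat \<Rightarrow> 'a::field_char_0 \<Rightarrow> 'a" where
  "bernoulli_fib_poly n x = of_nat (fib_fact n) * fps_nth (bernoulli_fib_gen x) n"

definition bernoulli_fib :: "nat \<Rightarrow> 'a::field_char_0" where
  "bernoulli_fib n = bernoulli_fib_poly n 0"

lemma fib_fact_pos: "fib_fact n > 0"
  unfolding fib_fact_def by (rule prod_pos) (auto intro!: fib_neq_0_nat)

lemma bernoulli_fib_gen_eq: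
  "bernoulli_fib_gen x = Abs_fps (\<lambda>n. bernoulli_fib_poly n x / of_nat (fib_fact n))"
  using fib_fact_pos by (intro fps_ext) (simp add: bernoulli_fib_poly_def less_imp_neq[symmetric])

lemma bernoulli_fib_gen_unique:
  "g = bernoulli_fib_gen x \<longleftrightarrow> (fib_exp 1 - 1) * g = fps_X * fib_exp x"
proof -
  let ?d = "fib_exp (1::'a) - 1"
  have d0: "fps_nth ?d 0 = 0" and d1: "fps_nth ?d 1 = 1"
    by (simp_all add: fib_exp_def fib_fact_def)
  have nz: "?d \<noteq> 0"
    using d1 by (metis fps_zero_nth zero_neq_one)
  have "subdegree ?d = 1"
    using d0 d1 by (intro subdegreeI) auto
  moreover have "fib_exp x \<noteq> 0"
    by (rule fps_nonzeroI[of _ 0]) (simp add: fib_exp_def fib_fact_def)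
  ultimately have "?d dvd fps_X * fib_exp x"
    using nz by (subst fps_dvd_iff) auto
  then show ?thesis
    using nz unfolding bernoulli_fib_gen_def by (metis dvd_mult_div_cancel nonzero_mult_div_cancel_left)
qed

end

theory Submission
  imports Defs
begin

text \<open>
  In the generating function \<open>z e(z x) / (e(z) - 1)\<close> the variable \<open>x\<close> enters only through
  the factor \<open>e(z x)\<close>, and this factor is \<open>1\<close> at \<open>x = 0\<close>. So the generating function of the
  polynomials is that of the numbers times the Golden exponential
  (\<open>bernoulli_fib_gen_factor\<close>). Comparing coefficients of \<open>z\<^sup>n\<close> in this Cauchy product gives
  the claim: the factor \<open>1 / (F\<^sub>j! F\<^bsub>n-j\<^esub>!)\<close> of each term becomes a Fibonomial coefficient
  after multiplication by \<open>F\<^sub>n!\<close>.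
\<close>

lemma fib_exp_0: "fib_exp 0 = 1"
  by (rule fps_ext) (simp add: fib_exp_def fib_fact_def power_0_left)

text \<open>
  Rewriting \<open>(a / d) * c\<close> as \<open>(a * c) / d\<close> can fail for power series when \<open>d\<close> does not
  divide \<open>a\<close>. Here exactness enters through \<open>bernoulli_fib_gen_unique\<close>: the product on the right
  solves the linear equation that characterizes the generating function.
\<close>

lemma bernoulli_fib_gen_factor: "bernoulli_fib_gen x = bernoulli_fib_gen 0 * fib_exp x"
proof -
  have "(fib_exp 1 - 1) * bernoulli_fib_gen 0 = (fps_X :: 'a fps)"
    using bernoulli_fib_gen_unique[of "bernoulli_fib_gen 0" "0 :: 'a"] by (simp add: fib_exp_0)
  then have "(fib_exp 1 - 1) * (bernoulli_fib_gen 0 * fib_exp x) = fps_X * fib_exp x"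
    by (simp add: mult.assoc[symmetric])
  then show ?thesis
    by (rule bernoulli_fib_gen_unique[THEN iffD2, symmetric])
qed

theorem proposition4p0p4:
  fixes x :: "'a::field_char_0" and n :: nat
  shows "bernoulli_fib_poly n x = (\<Sum>j=0..n. fibonomial n j * bernoulli_fib j * x ^ (n - j))"
proof -
  have "bernoulli_fib_poly n x = of_nat (fib_fact n) * fps_nth (bernoulli_fib_gen 0 * fib_exp x) n"
    by (simp add: bernoulli_fib_poly_def flip: bernoulli_fib_gen_factor)
  also have "\<dots> = (\<Sum>j=0..n. of_nat (fib_fact n) *
      ((bernoulli_fib j / of_nat (fib_fact j)) * (x ^ (n - j) / of_nat (fib_fact (n - j)))))"
    by (simp add: fps_mult_nth sum_distrib_left bernoulli_fib_gen_eq bernoulli_fib_def fib_exp_def)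
  also have "\<dots> = (\<Sum>j=0..n. fibonomial n j * bernoulli_fib j * x ^ (n - j))"
    by (simp add: fibonomial_def mult_ac)
  finally show ?thesis .
qed

end
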